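(* Let $\{|0\rangle,|1\rangle\}$ be an orthonormal basis of $\mathcal{H}_2$, $|v_\pm\rangle=\frac12|0\rangle\pm\frac{\sqrt3}{2}|1\rangle$, $|v_\pm^\perp\rangle=\frac{\sqrt3}{2}|0\rangle\mp\frac12|1\rangle$, and let $\mathcal{M},\mathcal{N}$ be the three-outcome qubit measurements $$M_1=\tfrac23|0\rangle\langle0|,\quad M_2=\tfrac23|v_+\rangle\langle v_+|,\quad M_3=\tfrac23|v_-\rangle\langle v_-|,$$ $$N_1=\tfrac23|1\rangle\langle1|,\quad N_2=\tfrac23|v_+^\perp\rangle\langle v_+^\perp|,\quad N_3=\tfrac23|v_-^\perp\rangle\langle v_-^\perp|.$$ Then $\mathcal{M}$ and $\mathcal{N}$ can be perfectly discriminated in a single use by a general (ancilla-assisted) test, but they cannot be perfectly discriminated by any simple (ancilla-free) test.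
   Context: $\mathcal{H}_2$ is the two-dimensional complex Hilbert space. A general (single-shot, ancilla-assisted) test $\mathcal{T}$ of three-outcome measurements with conclusions $c\in\{\mathcal{M},\mathcal{N}\}$ is a family of positive semidefinite operators $H^{(c)}_j$ on $\mathcal{H}_2$, $j=1,2,3$, with $H^{(\mathcal M)}_j+H^{(\mathcal N)}_j=\rho$ for every $j$, where $\rho\ge0$, $\mathrm{tr}[\rho]=1$ is independent of $j$. The probability of conclusion $c$ when the tested measurement has POVM $\{A_j\}$ is $p(c|\mathcal{A},\mathcal{T})=\sum_j \mathrm{tr}[H^{(c)}_jA_j]$. A simple (ancilla-free) test consists of a probe state $\varrho$ on $\mathcal{H}_2$ measured by the unknown measurement, followed by classical post-processing: conclusion $c$ is drawn with probability $q(c|j)$ given outcome $j$ (i.e. $H^{(c)}_j=q(c|j)\varrho$ with $q(c|j)\ge0$, $\sum_cq(c|j)=1$). A test perfectly discriminates $\mathcal{M}$ and $\mathcal{N}$ if $p(\mathcal N|\mathcal M,\mathcal T)=0=p(\mathcal M|\mathcal N,\mathcal T)$. *)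

theory Defs
  imports "HOL-Analysis.Analysis"
begin

text \<open>Outcomes are indexed by the three-element type \<open>3\<close>, whose elements are \<open>1\<close>, \<open>2\<close>, \<open>3\<close>
  (with \<open>3 = 0\<close>). Operators are matrices \<open>A $ row $ column\<close> in the standard basis of \<open>complex^2\<close>.\<close>

type_synonym qubit = "complex ^ 2"
type_synonym qubit_op = "complex ^ 2 ^ 2"
type_synonym measurement3 = "3 \<Rightarrow> qubit_op"

text \<open>The library's \<open>inner\<close> on \<open>complex^2\<close> is real-valued, so the Hermitian product is defined here;
  it is conjugate-linear in the first argument.\<close>

definition cinner :: "qubit \<Rightarrow> qubit \<Rightarrow> complex" where
  "cinner u v = (\<Sum>i\<in>UNIV. cnj (u $ i) * v $ i)"

text \<open>No spanning condition is needed, since two orthonormal vectors span \<open>complex^2\<close>.\<close>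

definition orthonormal_basis :: "qubit \<Rightarrow> qubit \<Rightarrow> bool" where
  "orthonormal_basis e0 e1 \<longleftrightarrow>
     cinner e0 e0 = 1 \<and> cinner e1 e1 = 1 \<and> cinner e0 e1 = 0"

definition ketbra :: "qubit \<Rightarrow> qubit \<Rightarrow> qubit_op" where
  "ketbra u v = (\<chi> i j. u $ i * cnj (v $ j))"

text \<open>Over the complex numbers this condition already forces \<open>A\<close> to be Hermitian.\<close>

definition psd :: "qubit_op \<Rightarrow> bool" where
  "psd A \<longleftrightarrow> (\<forall>v. cinner v (A *v v) \<in> \<real> \<and> 0 \<le> Re (cinner v (A *v v)))"

definition density :: "qubit_op \<Rightarrow> bool" where
  "density \<rho> \<longleftrightarrow> psd \<rho> \<and> trace \<rho> = 1"

definition povm :: "measurement3 \<Rightarrow> bool" where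
  "povm A \<longleftrightarrow> (\<forall>j. psd (A j)) \<and> (\<Sum>j\<in>UNIV. A j) = mat 1"

datatype conclusion = Concl_M | Concl_N

type_synonym test = "conclusion \<Rightarrow> 3 \<Rightarrow> qubit_op"

definition general_test :: "test \<Rightarrow> bool" where
  "general_test H \<longleftrightarrow>
     (\<forall>c j. psd (H c j)) \<and>
     (\<exists>\<rho>. density \<rho> \<and> (\<forall>j. H Concl_M j + H Concl_N j = \<rho>))"

text \<open>A simple test has probe state \<open>\<rho>\<close> and post-processing probabilities \<open>q c j\<close>, the
  probability of conclusion \<open>c\<close> given outcome \<open>j\<close>.\<close>

definition simple_test :: "test \<Rightarrow> bool" where
  "simple_test H \<longleftrightarrow>
     (\<exists>(\<rho> :: qubit_op) (q :: conclusion \<Rightarrow> 3 \<Rightarrow> real).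
        density \<rho> \<and>
        (\<forall>c j. 0 \<le> q c j) \<and> (\<forall>j. q Concl_M j + q Concl_N j = 1) \<and>
        (\<forall>c j. H c j = q c j *\<^sub>R \<rho>))"

text \<open>Complex-typed because \<open>trace\<close> is; the value is real when \<open>H\<close> is a test and \<open>A\<close> a POVM.\<close>

definition concl_prob :: "test \<Rightarrow> conclusion \<Rightarrow> measurement3 \<Rightarrow> complex" where
  "concl_prob H c A = (\<Sum>j\<in>UNIV. trace (H c j ** A j))"

definition perfectly_discriminates :: "test \<Rightarrow> measurement3 \<Rightarrow> measurement3 \<Rightarrow> bool" where
  "perfectly_discriminates H M N \<longleftrightarrow>
     concl_prob H Concl_N M = 0 \<and> concl_prob H Concl_M N = 0"

definition v_plus :: "qubit \<Rightarrow> qubit \<Rightarrow> qubit" where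
  "v_plus e0 e1 = (1/2) *\<^sub>R e0 + (sqrt 3 / 2) *\<^sub>R e1"

definition v_minus :: "qubit \<Rightarrow> qubit \<Rightarrow> qubit" where
  "v_minus e0 e1 = (1/2) *\<^sub>R e0 - (sqrt 3 / 2) *\<^sub>R e1"

definition v_plus_perp :: "qubit \<Rightarrow> qubit \<Rightarrow> qubit" where
  "v_plus_perp e0 e1 = (sqrt 3 / 2) *\<^sub>R e0 - (1/2) *\<^sub>R e1"

definition v_minus_perp :: "qubit \<Rightarrow> qubit \<Rightarrow> qubit" where
  "v_minus_perp e0 e1 = (sqrt 3 / 2) *\<^sub>R e0 + (1/2) *\<^sub>R e1"

definition meas_M :: "qubit \<Rightarrow> qubit \<Rightarrow> measurement3" where
  "meas_M e0 e1 j =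
     (if j = 1 then (2/3) *\<^sub>R ketbra e0 e0
      else if j = 2 then (2/3) *\<^sub>R ketbra (v_plus e0 e1) (v_plus e0 e1)
      else (2/3) *\<^sub>R ketbra (v_minus e0 e1) (v_minus e0 e1))"

definition meas_N :: "qubit \<Rightarrow> qubit \<Rightarrow> measurement3" where
  "meas_N e0 e1 j =
     (if j = 1 then (2/3) *\<^sub>R ketbra e1 e1
      else if j = 2 then (2/3) *\<^sub>R ketbra (v_plus_perp e0 e1) (v_plus_perp e0 e1)
      else (2/3) *\<^sub>R ketbra (v_minus_perp e0 e1) (v_minus_perp e0 e1))"

lemma psd_scaled_ketbra:
  assumes "0 \<le> r"
  shows "psd (r *\<^sub>R ketbra u u)"
proof -
  have "cinner v ((r *\<^sub>R ketbra u u) *v v) = of_real r * (cinner u v * cnj (cinner u v))" for v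
    by (simp add: cinner_def ketbra_def matrix_vector_mult_def sum_2
        scaleR_conv_of_real[where 'a = complex] algebra_simps)
  then have "cinner v ((r *\<^sub>R ketbra u u) *v v) = of_real (r * (cmod (cinner u v))\<^sup>2)" for v
    by (simp only: complex_norm_square of_real_mult)
  then show ?thesis
    using assms by (simp add: psd_def)
qed

lemma ketbra_resolution:
  assumes "orthonormal_basis e0 e1"
  shows "ketbra e0 e0 + ketbra e1 e1 = mat 1"
proof -
  define U :: qubit_op where "U = (\<chi> i j. if j = 1 then e0 $ i else e1 $ i)"
  define V :: qubit_op where "V = (\<chi> i j. if i = 1 then cnj (e0 $ j) else cnj (e1 $ j))"
  have 0: "cinner e1 e0 = 0"
  proof -
    have "cinner e1 e0 = cnj (cinner e0 e1)"
      by (simp add: cinner_def sum_2 mult.commute)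
    then show ?thesis using assms by (simp add: orthonormal_basis_def)
  qed
  have "V ** U = mat 1"
    using assms 0
    by (simp add: orthonormal_basis_def cinner_def U_def V_def matrix_matrix_mult_def mat_def
        vec_eq_iff forall_2 sum_2)
  then have "U ** V = mat 1"
    by (simp add: matrix_left_right_inverse)
  then show ?thesis
    by (simp add: ketbra_def U_def V_def matrix_matrix_mult_def mat_def vec_eq_iff forall_2 sum_2)
qed

lemma sqrt3_cancel: "complex_of_real (sqrt 3) * (complex_of_real (sqrt 3) * x) = 3 * x"
  by (simp flip: mult.assoc of_real_mult)

lemma meas_M_povm:
  assumes "orthonormal_basis e0 e1"
  shows "povm (meas_M e0 e1)"
proof -
  have "(\<Sum>j\<in>UNIV. meas_M e0 e1 j) = ketbra e0 e0 + ketbra e1 e1"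
    by (simp add: sum_3 meas_M_def v_plus_def v_minus_def ketbra_def vec_eq_iff
        scaleR_conv_of_real[where 'a = complex] sqrt3_cancel field_simps)
  then show ?thesis
    using ketbra_resolution[OF assms] by (simp add: povm_def meas_M_def psd_scaled_ketbra)
qed

lemma meas_N_povm:
  assumes "orthonormal_basis e0 e1"
  shows "povm (meas_N e0 e1)"
proof -
  have "(\<Sum>j\<in>UNIV. meas_N e0 e1 j) = ketbra e0 e0 + ketbra e1 e1"
    by (simp add: sum_3 meas_N_def v_plus_perp_def v_minus_perp_def ketbra_def vec_eq_iff
        scaleR_conv_of_real[where 'a = complex] sqrt3_cancel field_simps)
  then show ?thesis
    using ketbra_resolution[OF assms] by (simp add: povm_def meas_N_def psd_scaled_ketbra)
qed

end

(* Each pair (m_j, n_j) of vectors underlying M_j and N_j is an orthonormal basis. The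
   ancilla-assisted test built from a maximally entangled probe has H^(M)_j = |m_j><m_j| / 2
   and H^(N)_j = |n_j><n_j| / 2, which sum to I/2 and annihilate the wrong measurement.
   In a perfect simple test the probe state must, for every j, have zero expectation in m_j or in
   n_j. In terms of the expectations a + b = 1 in e0, e1 and of the real coherence d, the case
   j = 1 makes a or b zero; then j = 2 and j = 3 put d into two disjoint sets. *)
theory Submission
  imports Defs
begin

text \<open>With real coefficients the Hermitian product of two combinations of \<open>e0\<close>,
  \<open>e1\<close> is the Euclidean dot product of their coefficient pairs, so real orthogonal
  changes of basis preserve orthonormality.\<close>

lemma orthonormal_basis_rotate:
  assumes "orthonormal_basis e0 e1"
    and "a\<^sup>2 + b\<^sup>2 = 1" "c\<^sup>2 + d\<^sup>2 = 1" "a * c + b * d = 0"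
  shows "orthonormal_basis (a *\<^sub>R e0 + b *\<^sub>R e1) (c *\<^sub>R e0 + d *\<^sub>R e1)"
proof -
  have "cinner e1 e0 = cnj (cinner e0 e1)"
    by (simp add: cinner_def sum_2 mult.commute)
  then have ip: "cinner e0 e0 = 1" "cinner e1 e1 = 1" "cinner e0 e1 = 0" "cinner e1 e0 = 0"
    using assms(1) by (simp_all add: orthonormal_basis_def)
  have exp: "cinner (p *\<^sub>R e0 + q *\<^sub>R e1) (r *\<^sub>R e0 + s *\<^sub>R e1) = of_real (p * r + q * s)"
    for p q r s :: real
  proof -
    have "cinner (p *\<^sub>R e0 + q *\<^sub>R e1) (r *\<^sub>R e0 + s *\<^sub>R e1) =
        of_real (p * r) * cinner e0 e0 + of_real (p * s) * cinner e0 e1 +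
        of_real (q * r) * cinner e1 e0 + of_real (q * s) * cinner e1 e1"
      by (simp add: cinner_def sum_2 scaleR_conv_of_real[where 'a = complex] algebra_simps)
    then show ?thesis
      by (simp add: ip)
  qed
  show ?thesis
    unfolding orthonormal_basis_def exp using assms(2-4) by (simp add: power2_eq_square)
qed

lemma orthonormal_basis_v_plus:
  "orthonormal_basis e0 e1 \<Longrightarrow> orthonormal_basis (v_plus e0 e1) (v_plus_perp e0 e1)"
  using orthonormal_basis_rotate[of e0 e1 "1/2" "sqrt 3 / 2" "sqrt 3 / 2" "- (1/2)"]
  by (simp add: v_plus_def v_plus_perp_def power_divide)

lemma orthonormal_basis_v_minus:
  "orthonormal_basis e0 e1 \<Longrightarrow> orthonormal_basis (v_minus e0 e1) (v_minus_perp e0 e1)"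
  using orthonormal_basis_rotate[of e0 e1 "1/2" "- (sqrt 3 / 2)" "sqrt 3 / 2" "1/2"]
  by (simp add: v_minus_def v_minus_perp_def power_divide)

lemma trace_mult_ketbra: "trace (A ** ketbra u u) = cinner u (A *v u)"
  by (simp add: trace_def matrix_matrix_mult_def ketbra_def cinner_def matrix_vector_mult_def
      sum_2 algebra_simps)

text \<open>The trace is the squared modulus of the overlap of \<open>u\<close> and
  \<open>v\<close>. Both orders serve, one for each kind of wrong conclusion.\<close>

lemma trace_ketbra_orthogonal:
  assumes "orthonormal_basis u v"
  shows "trace (ketbra u u ** ketbra v v) = 0" "trace (ketbra v v ** ketbra u u) = 0"
proof -
  have "trace (ketbra u u ** ketbra v v) = cinner u v * cnj (cinner u v)"
    by (simp add: trace_def matrix_matrix_mult_def ketbra_def cinner_def sum_2 algebra_simps)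
  then show "trace (ketbra u u ** ketbra v v) = 0"
    using assms by (simp add: orthonormal_basis_def)
  then show "trace (ketbra v v ** ketbra u u) = 0"
    by (metis trace_mul_sym)
qed

lemma trace_scaleR: "trace (r *\<^sub>R (A :: qubit_op)) = r *\<^sub>R trace A"
  by (simp add: trace_def sum_2 scaleR_add_right)

lemma scaleR_matrix_mult:
  "((r *\<^sub>R A) ** (s *\<^sub>R B) :: qubit_op) = (r * s) *\<^sub>R (A ** B)"
  by (simp add: matrix_matrix_mult_def vec_eq_iff scaleR_right.sum mult.commute)

lemma perfect_general_test:
  assumes "orthonormal_basis e0 e1"
  shows "\<exists>T. general_test T \<and> perfectly_discriminates T (meas_M e0 e1) (meas_N e0 e1)"
proof -
  \<comment> \<open>The factor 3/4 turns the weight 2/3 of the measurement operators into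
    1/2.\<close>
  define T :: test where
    "T c j = (3/4) *\<^sub>R (case c of Concl_M \<Rightarrow> meas_M e0 e1 j | Concl_N \<Rightarrow> meas_N e0 e1 j)" for c j
  note bases = assms orthonormal_basis_v_plus[OF assms] orthonormal_basis_v_minus[OF assms]
  have "psd (T c j)" for c j
    by (cases c) (simp_all add: T_def meas_M_def meas_N_def psd_scaled_ketbra)
  moreover have "density ((1/2) *\<^sub>R mat 1)"
  proof -
    have "cinner v (((1/2) *\<^sub>R mat 1 :: qubit_op) *v v) =
        of_real (((cmod (v $ 1))\<^sup>2 + (cmod (v $ 2))\<^sup>2) / 2)" for v
      unfolding of_real_divide of_real_add complex_norm_square
      by (simp add: cinner_def matrix_vector_mult_def mat_def sum_2
          scaleR_conv_of_real[where 'a = complex] field_simps)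
    then have "psd ((1/2) *\<^sub>R mat 1)"
      unfolding psd_def by (simp only: Reals_of_real Re_complex_of_real) simp
    then show ?thesis
      by (simp add: density_def trace_def mat_def sum_2 scaleR_conv_of_real[where 'a = complex])
  qed
  moreover have "T Concl_M j + T Concl_N j = (1/2) *\<^sub>R mat 1" for j
    \<comment> \<open>Each outcome has its own orthonormal basis, but all three resolve the same
      identity, so the sum is independent of \<open>j\<close>.\<close>
    using bases[THEN ketbra_resolution]
    by (simp add: T_def meas_M_def meas_N_def flip: scaleR_add_right)
  ultimately have "general_test T"
    unfolding general_test_def by blast
  moreover have "perfectly_discriminates T (meas_M e0 e1) (meas_N e0 e1)"
    using bases[THEN trace_ketbra_orthogonal(1)] bases[THEN trace_ketbra_orthogonal(2)]
    by (simp add: perfectly_discriminates_def concl_prob_def sum_3 T_def meas_M_def meas_N_def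
        scaleR_matrix_mult trace_scaleR)
  ultimately show ?thesis
    by blast
qed

lemma no_perfect_simple_test:
  assumes basis: "orthonormal_basis e0 e1"
    and "simple_test T"
    and perfect: "perfectly_discriminates T (meas_M e0 e1) (meas_N e0 e1)"
  shows False
proof -
  obtain \<rho> q where \<rho>: "density \<rho>" and q_nonneg: "\<And>c j. 0 \<le> q c j"
    and q_sum: "\<And>j. q Concl_M j + q Concl_N j = 1" and T: "\<And>c j. T c j = q c j *\<^sub>R \<rho>"
    using assms(2) unfolding simple_test_def by blast
  define f where "f u = Re (cinner u (\<rho> *v u))" for u
  have f_nonneg: "0 \<le> f u" for u
    using \<rho> by (simp add: density_def psd_def f_def)
  have q_cases: "q Concl_M j \<noteq> 0 \<or> q Concl_N j \<noteq> 0" for j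
    using q_sum[of j] by linarith
  have prob_M: "Re (concl_prob T c (meas_M e0 e1)) =
      2/3 * (q c 1 * f e0 + q c 2 * f (v_plus e0 e1) + q c 3 * f (v_minus e0 e1))" for c
    by (simp add: concl_prob_def sum_3 T meas_M_def scaleR_matrix_mult trace_scaleR
        trace_mult_ketbra f_def field_simps)
  have prob_N: "Re (concl_prob T c (meas_N e0 e1)) =
      2/3 * (q c 1 * f e1 + q c 2 * f (v_plus_perp e0 e1) + q c 3 * f (v_minus_perp e0 e1))" for c
    by (simp add: concl_prob_def sum_3 T meas_N_def scaleR_matrix_mult trace_scaleR
        trace_mult_ketbra f_def field_simps)
  have nonneg: "0 \<le> q c j * f u" for c j u
    using q_nonneg f_nonneg by simp
  have "Re (concl_prob T Concl_N (meas_M e0 e1)) = 0" "Re (concl_prob T Concl_M (meas_N e0 e1)) = 0"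
    using perfect by (simp_all add: perfectly_discriminates_def)
  note sums = this[unfolded prob_M prob_N]
  \<comment> \<open>An error probability is a sum of nonnegative terms, so if it vanishes, every
    term does.\<close>
  have "q Concl_N 1 * f e0 = 0 \<and> q Concl_N 2 * f (v_plus e0 e1) = 0 \<and>
      q Concl_N 3 * f (v_minus e0 e1) = 0"
    using sums(1) by (simp add: add_nonneg_eq_0_iff nonneg)
  moreover have "q Concl_M 1 * f e1 = 0 \<and> q Concl_M 2 * f (v_plus_perp e0 e1) = 0 \<and>
      q Concl_M 3 * f (v_minus_perp e0 e1) = 0"
    using sums(2) by (simp add: add_nonneg_eq_0_iff nonneg)
  ultimately have zeros: "f e0 = 0 \<or> f e1 = 0"
    "f (v_plus e0 e1) = 0 \<or> f (v_plus_perp e0 e1) = 0"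
    "f (v_minus e0 e1) = 0 \<or> f (v_minus_perp e0 e1) = 0"
    using q_cases by (metis mult_eq_0_iff)+
  \<comment> \<open>The factor \<open>sqrt 3\<close> is absorbed because the coefficient products
    \<open>x * y\<close> below are \<open>sqrt 3 / 4\<close> up to sign; this keeps the final system
    linear with rational coefficients.\<close>
  define d where "d = sqrt 3 * Re (cinner e0 (\<rho> *v e1) + cinner e1 (\<rho> *v e0))"
  have f_real_comb: "f (x *\<^sub>R e0 + y *\<^sub>R e1) = x\<^sup>2 * f e0 + y\<^sup>2 * f e1 +
      x * y * Re (cinner e0 (\<rho> *v e1) + cinner e1 (\<rho> *v e0))" for x y
    by (simp add: f_def cinner_def matrix_vector_mult_def sum_2 power2_eq_square algebra_simps)
  have f_v: "f (v_plus e0 e1) = f e0 / 4 + 3 * f e1 / 4 + d / 4"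
    "f (v_minus e0 e1) = f e0 / 4 + 3 * f e1 / 4 - d / 4"
    "f (v_plus_perp e0 e1) = 3 * f e0 / 4 + f e1 / 4 - d / 4"
    "f (v_minus_perp e0 e1) = 3 * f e0 / 4 + f e1 / 4 + d / 4"
    using f_real_comb[of "1/2" "sqrt 3 / 2"] f_real_comb[of "1/2" "- (sqrt 3 / 2)"]
      f_real_comb[of "sqrt 3 / 2" "- (1/2)"] f_real_comb[of "sqrt 3 / 2" "1/2"]
    by (simp_all add: v_plus_def v_minus_def v_plus_perp_def v_minus_perp_def d_def power_divide)
  have "trace (\<rho> ** (ketbra e0 e0 + ketbra e1 e1)) = 1"
    using \<rho> by (simp add: ketbra_resolution[OF basis] density_def)
  then have "cinner e0 (\<rho> *v e0) + cinner e1 (\<rho> *v e1) = 1"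
    by (simp add: matrix_add_ldistrib trace_add trace_mult_ketbra)
  then have "f e0 + f e1 = 1"
    unfolding f_def by (metis one_complex.sel(1) plus_complex.sel(1))
  \<comment> \<open>If \<open>f e0 = 0\<close>, then \<open>f e1 = 1\<close>; outcome 2 forces
    \<open>d\<close> to be -3 or 1, outcome 3 forces it to be 3 or -1. If \<open>f e1 = 0\<close>,
    the two sets are exchanged.\<close>
  with zeros f_v show False
    by (elim disjE) linarith+
qed

theorem mainTheorem7:
  fixes e0 e1 :: "complex ^ 2"
  assumes "orthonormal_basis e0 e1"
  shows "(\<exists>T. general_test T \<and> perfectly_discriminates T (meas_M e0 e1) (meas_N e0 e1)) \<and>
         \<not> (\<exists>T. simple_test T \<and> perfectly_discriminates T (meas_M e0 e1) (meas_N e0 e1))"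
  using perfect_general_test[OF assms] no_perfect_simple_test[OF assms] by blast

end
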